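(* Let $N\ge 2$, let $\Omega\subset\mathbb{R}^N$ be a bounded domain with $C^{1,1}$ boundary, and let $p\ge 2$, $s\in(0,1)$ with $ps<N$. Let $g\in C^0(\mathbb{R})\cap BV_{\rm loc}(\mathbb{R})$, let $u,v\in W^{s,p}_0(\Omega)\cap C^0(\overline\Omega)$ with $u\not\equiv v$, and let $K>0$ be such that $$(-\Delta)_p^s\,v+g(v)\le(-\Delta)_p^s\,u+g(u)\le K\ \text{ weakly in }\Omega,\qquad 0<v\le u\ \text{ in }\Omega.$$ Then $u>v$ in $\Omega$. In particular, if $u,v\in\mathrm{int}(C_s^0(\overline\Omega)_+)$, then $u-v\in\mathrm{int}(C_s^0(\overline\Omega)_+)$.
   Context: Functions on $\Omega$ are identified with their extension by $0$ to $\mathbb{R}^N$; $\Omega^c=\mathbb{R}^N\setminus\Omega$; $\mathrm{d}_\Omega(x)=\mathrm{dist}(x,\Omega^c)$. $BV_{\rm loc}(\mathbb{R})$ denotes functions of bounded variation on every compact interval. Function spaces: $[u]_{s,p}=\Big(\iint_{\mathbb{R}^N\times\mathbb{R}^N}\frac{|u(x)-u(y)|^p}{|x-y|^{N+ps}}\,dx\,dy\Big)^{1/p}$, $W^{s,p}(\mathbb{R}^N)=\{u\in L^p(\mathbb{R}^N):[u]_{s,p}<\infty\}$, and $W^{s,p}_0(\Omega)=\{u\in W^{s,p}(\mathbb{R}^N): u=0\text{ a.e. in }\Omega^c\}$ with norm $\|u\|=[u]_{s,p}$; $W^{s,p}_0(\Omega)_+$ is the set of its nonnegative elements. $C_s^0(\overline\Omega)=\{u\in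 C^0(\overline\Omega): u/\mathrm{d}_\Omega^s\text{ has a continuous extension to }\overline\Omega\}$ with norm $\|u\|_{0,s}=\|u/\mathrm{d}_\Omega^s\|_\infty$; $C_s^0(\overline\Omega)_+$ is its cone of nonnegative functions, whose interior is $\mathrm{int}(C_s^0(\overline\Omega)_+)=\{u\in C_s^0(\overline\Omega):\inf_\Omega u/\mathrm{d}_\Omega^s>0\}$. Fractional $p$-Laplacian: for $u,\varphi\in W^{s,p}_0(\Omega)$, $$\langle(-\Delta)_p^s\,u,\varphi\rangle=\iint_{\mathbb{R}^N\times\mathbb{R}^N}\frac{|u(x)-u(y)|^{p-2}(u(x)-u(y))(\varphi(x)-\varphi(y))}{|x-y|^{N+ps}}\,dx\,dy.$$ The inequalities hold weakly in $\Omega$ in the sense that for all $\varphi\in W^{s,p}_0(\Omega)_+$, $$\langle(-\Delta)_p^s\,v,\varphi\rangle+\int_\Omega g(v)\varphi\,dx\le\langle(-\Delta)_p^s\,u,\varphi\rangle+\int_\Omega g(u)\varphi\,dx\le K\int_\Omega\varphi\,dx.$$ *)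

theory Defs
  imports "HOL-Analysis.Analysis"
begin

text \<open>
  Functions on \<open>\<Omega>\<close> or on its closure are total functions on the ambient Euclidean space, and
  \<open>N = DIM('a)\<close>. Measure and integration are with respect to \<^const>\<open>lebesgue\<close>, both on \<open>'a\<close> and on
  \<open>'a \<times> 'a\<close>.
\<close>

text \<open>
  Near each boundary point, \<open>\<Omega>\<close> is the strict epigraph, in direction \<open>e\<close>, of a \<open>C\<^sup>1\<^sup>,\<^sup>1\<close> function of
  the component orthogonal to \<open>e\<close>. The graph function \<open>\<gamma>\<close> is only evaluated on the hyperplane
  orthogonal to \<open>e\<close>; it is declared on the whole space, a function on the hyperplane being
  extended constantly along \<open>e\<close>.
\<close>

definition C11_boundary :: "'a::euclidean_space set \<Rightarrow> bool" where
  "C11_boundary \<Omega> \<longleftrightarrow>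
    (\<forall>x0\<in>frontier \<Omega>. \<exists>r>0. \<exists>e. norm e = 1 \<and>
      (\<exists>(\<gamma> :: 'a \<Rightarrow> real) G L. (\<forall>z. GDERIV \<gamma> z :> G z) \<and> L-lipschitz_on UNIV G \<and>
        \<Omega> \<inter> ball x0 r = {y \<in> ball x0 r. y \<bullet> e > \<gamma> (y - (y \<bullet> e) *\<^sub>R e)}))"

definition bounded_C11_domain :: "'a::euclidean_space set \<Rightarrow> bool" where
  "bounded_C11_domain \<Omega> \<longleftrightarrow>
    open \<Omega> \<and> connected \<Omega> \<and> \<Omega> \<noteq> {} \<and> bounded \<Omega> \<and> C11_boundary \<Omega>"

definition dist_compl :: "'a::euclidean_space set \<Rightarrow> 'a \<Rightarrow> real" where
  "dist_compl \<Omega> x = infdist x (- \<Omega>)"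

definition bounded_variation_on_interval :: "real \<Rightarrow> real \<Rightarrow> (real \<Rightarrow> real) \<Rightarrow> bool" where
  "bounded_variation_on_interval a b g \<longleftrightarrow>
    (\<exists>M. \<forall>(n::nat) (t :: nat \<Rightarrow> real).
      mono_on {..n} t \<and> t ` {..n} \<subseteq> {a..b} \<longrightarrow> (\<Sum>i<n. \<bar>g (t (Suc i)) - g (t i)\<bar>) \<le> M)"

definition BV_loc :: "(real \<Rightarrow> real) set" where
  "BV_loc = {g. \<forall>a b. bounded_variation_on_interval a b g}"

text \<open>The \<open>p\<close>-th power of the Gagliardo seminorm, possibly infinite.\<close>

definition gagliardo_pow :: "real \<Rightarrow> real \<Rightarrow> ('a::euclidean_space \<Rightarrow> real) \<Rightarrow> ennreal" where
  "gagliardo_pow s p u =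
    (\<integral>\<^sup>+ (x, y). ennreal (\<bar>u x - u y\<bar> powr p / norm (x - y) powr (real DIM('a) + p * s)) \<partial>lebesgue)"

definition Wsp :: "real \<Rightarrow> real \<Rightarrow> ('a::euclidean_space \<Rightarrow> real) set" where
  "Wsp s p = {u. u \<in> borel_measurable lebesgue \<and> integrable lebesgue (\<lambda>x. \<bar>u x\<bar> powr p) \<and>
                 gagliardo_pow s p u < \<infinity>}"

definition Wsp0 :: "real \<Rightarrow> real \<Rightarrow> 'a::euclidean_space set \<Rightarrow> ('a \<Rightarrow> real) set" where
  "Wsp0 s p \<Omega> = {u \<in> Wsp s p. AE x in lebesgue. x \<notin> \<Omega> \<longrightarrow> u x = 0}"

definition Wsp0_nonneg :: "real \<Rightarrow> real \<Rightarrow> 'a::euclidean_space set \<Rightarrow> ('a \<Rightarrow> real) set" where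
  "Wsp0_nonneg s p \<Omega> = {u \<in> Wsp0 s p \<Omega>. AE x in lebesgue. 0 \<le> u x}"

text \<open>
  The pairing of the fractional \<open>p\<close>-Laplacian of \<open>u\<close> with \<open>\<phi>\<close>. For \<open>p = 2\<close> and \<open>u x = u y\<close>, the
  convention \<open>0 powr 0 = 0\<close> is harmless because of the factor \<open>u x - u y\<close>.
\<close>

definition frac_plap ::
  "real \<Rightarrow> real \<Rightarrow> ('a::euclidean_space \<Rightarrow> real) \<Rightarrow> ('a \<Rightarrow> real) \<Rightarrow> real" where
  "frac_plap s p u \<phi> =
    (\<integral> (x, y). \<bar>u x - u y\<bar> powr (p - 2) * (u x - u y) * (\<phi> x - \<phi> y)
        / norm (x - y) powr (real DIM('a) + p * s) \<partial>lebesgue)"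

text \<open>
  Only the values on the closure of \<open>\<Omega>\<close> matter for membership in the following sets.
\<close>

definition Cs0 :: "real \<Rightarrow> 'a::euclidean_space set \<Rightarrow> ('a \<Rightarrow> real) set" where
  "Cs0 s \<Omega> = {u. continuous_on (closure \<Omega>) u \<and>
     (\<exists>w. continuous_on (closure \<Omega>) w \<and> (\<forall>x\<in>\<Omega>. w x = u x / dist_compl \<Omega> x powr s))}"

definition Cs0_norm :: "real \<Rightarrow> 'a::euclidean_space set \<Rightarrow> ('a \<Rightarrow> real) \<Rightarrow> real" where
  "Cs0_norm s \<Omega> u = (SUP x\<in>\<Omega>. \<bar>u x / dist_compl \<Omega> x powr s\<bar>)"

definition Cs0_nonneg :: "real \<Rightarrow> 'a::euclidean_space set \<Rightarrow> ('a \<Rightarrow> real) set" where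
  "Cs0_nonneg s \<Omega> = {u \<in> Cs0 s \<Omega>. \<forall>x\<in>closure \<Omega>. 0 \<le> u x}"

text \<open>
  Topological interior with respect to \<^const>\<open>Cs0_norm\<close>; \<open>int_Cs0_nonneg_iff\<close> below gives the usual description.
\<close>

definition int_Cs0_nonneg :: "real \<Rightarrow> 'a::euclidean_space set \<Rightarrow> ('a \<Rightarrow> real) set" where
  "int_Cs0_nonneg s \<Omega> = {u \<in> Cs0_nonneg s \<Omega>.
     \<exists>\<epsilon>>0. \<forall>w\<in>Cs0 s \<Omega>. Cs0_norm s \<Omega> (\<lambda>x. w x - u x) < \<epsilon> \<longrightarrow> w \<in> Cs0_nonneg s \<Omega>}"

lemma dist_compl_pos:
  fixes \<Omega> :: "'a::euclidean_space set"
  assumes "open \<Omega>" "bounded \<Omega>" "x \<in> \<Omega>"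
  shows "0 < dist_compl \<Omega> x"
proof -
  have "- \<Omega> \<noteq> {}"
    using assms(2) not_bounded_UNIV by (metis Compl_empty_eq double_complement)
  then show ?thesis
    using assms infdist_pos_not_in_closed[of "- \<Omega>" x] by (auto simp: dist_compl_def closed_def)
qed

lemma Cs0_bounded:
  assumes "bounded \<Omega>" "u \<in> Cs0 s \<Omega>"
  shows "\<exists>B. \<forall>x\<in>\<Omega>. \<bar>u x / dist_compl \<Omega> x powr s\<bar> \<le> B"
proof -
  obtain w where w: "continuous_on (closure \<Omega>) w"
      "\<And>x. x \<in> \<Omega> \<Longrightarrow> w x = u x / dist_compl \<Omega> x powr s"
    using assms(2) unfolding Cs0_def by blast
  have "bounded (w ` closure \<Omega>)"
    using assms(1) w(1) by (intro compact_imp_bounded compact_continuous_image) auto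
  then obtain B where "\<forall>x\<in>closure \<Omega>. \<bar>w x\<bar> \<le> B"
    unfolding bounded_iff by auto
  then show ?thesis
    using w(2) closure_subset by (metis subsetD)
qed

lemma Cs0_diff:
  assumes "u \<in> Cs0 s \<Omega>" "v \<in> Cs0 s \<Omega>"
  shows "(\<lambda>x. u x - v x) \<in> Cs0 s \<Omega>"
proof -
  obtain a b where "continuous_on (closure \<Omega>) a" "continuous_on (closure \<Omega>) b"
      "\<forall>x\<in>\<Omega>. a x = u x / dist_compl \<Omega> x powr s" "\<forall>x\<in>\<Omega>. b x = v x / dist_compl \<Omega> x powr s"
    using assms unfolding Cs0_def by blast
  then show ?thesis
    using assms unfolding Cs0_def
    by (auto intro!: continuous_intros exI[of _ "\<lambda>x. a x - b x"] simp: diff_divide_distrib)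
qed

lemma Cs0_weight:
  fixes \<Omega> :: "'a::euclidean_space set"
  assumes "open \<Omega>" "bounded \<Omega>" "0 < s"
  shows "(\<lambda>x. c * dist_compl \<Omega> x powr s) \<in> Cs0 s \<Omega>"
proof -
  have "continuous_on (closure \<Omega>) (\<lambda>x. c * dist_compl \<Omega> x powr s)"
    unfolding dist_compl_def using assms(3)
    by (intro continuous_on_mult continuous_on_powr' continuous_on_infdist
          continuous_on_const continuous_on_id) (auto simp: infdist_nonneg)
  moreover have "c = c * dist_compl \<Omega> x powr s / dist_compl \<Omega> x powr s" if "x \<in> \<Omega>" for x
    using dist_compl_pos[OF assms(1,2) that] by simp
  ultimately show ?thesis
    unfolding Cs0_def by (auto intro!: exI[of _ "\<lambda>x. c"])
qed

lemma nonneg_closure: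
  fixes u :: "'a::euclidean_space \<Rightarrow> real"
  assumes "continuous_on (closure \<Omega>) u" "\<And>x. x \<in> \<Omega> \<Longrightarrow> 0 \<le> u x" "x \<in> closure \<Omega>"
  shows "0 \<le> u x"
  using continuous_ge_on_closure[OF assms(1) assms(3), of 0] assms(2) by auto

lemma int_Cs0_nonneg_iff:
  fixes \<Omega> :: "'a::euclidean_space set"
  assumes \<Omega>: "open \<Omega>" "bounded \<Omega>" "\<Omega> \<noteq> {}" and s: "0 < s"
  shows "int_Cs0_nonneg s \<Omega> =
    {u \<in> Cs0 s \<Omega>. 0 < (INF x\<in>\<Omega>. u x / dist_compl \<Omega> x powr s)}"
proof (intro set_eqI iffI)
  fix u :: "'a \<Rightarrow> real"
  let ?q = "\<lambda>u x. u x / dist_compl \<Omega> x powr s"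
  have dpos: "0 < dist_compl \<Omega> x powr s" if "x \<in> \<Omega>" for x
    using dist_compl_pos[OF \<Omega>(1,2) that] by simp
  {
    assume "u \<in> int_Cs0_nonneg s \<Omega>"
    then obtain \<epsilon> where u: "u \<in> Cs0 s \<Omega>" and \<epsilon>: "\<epsilon> > 0"
      and ball: "\<And>w. w \<in> Cs0 s \<Omega> \<Longrightarrow> Cs0_norm s \<Omega> (\<lambda>x. w x - u x) < \<epsilon> \<Longrightarrow> w \<in> Cs0_nonneg s \<Omega>"
      unfolding int_Cs0_nonneg_def Cs0_nonneg_def by auto
    define w where "w = (\<lambda>x. u x - \<epsilon>/2 * dist_compl \<Omega> x powr s)"
    have "w \<in> Cs0 s \<Omega>"
      unfolding w_def by (intro Cs0_diff u Cs0_weight \<Omega> s)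
    moreover have "Cs0_norm s \<Omega> (\<lambda>x. w x - u x) = (SUP x\<in>\<Omega>. \<epsilon>/2)"
      unfolding Cs0_norm_def w_def using \<epsilon>
      by (intro SUP_cong refl) (use dpos in \<open>fastforce simp: abs_mult\<close>)
    ultimately have "w \<in> Cs0_nonneg s \<Omega>"
      using ball[of w] \<Omega>(3) \<epsilon> by simp
    then have "\<epsilon>/2 \<le> ?q u x" if "x \<in> \<Omega>" for x
      using that dpos[OF that] closure_subset[of \<Omega>] unfolding Cs0_nonneg_def w_def
      by (auto simp: field_simps)
    then have "\<epsilon>/2 \<le> (INF x\<in>\<Omega>. ?q u x)"
      using \<Omega>(3) by (intro cINF_greatest) auto
    then show "u \<in> {u \<in> Cs0 s \<Omega>. 0 < (INF x\<in>\<Omega>. ?q u x)}"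
      using u \<epsilon> by simp
  next
    define c where "c = (INF x\<in>\<Omega>. ?q u x)"
    assume "u \<in> {u \<in> Cs0 s \<Omega>. 0 < (INF x\<in>\<Omega>. ?q u x)}"
    then have u: "u \<in> Cs0 s \<Omega>" and c: "0 < c"
      by (auto simp: c_def)
    obtain B where "\<forall>x\<in>\<Omega>. \<bar>?q u x\<bar> \<le> B"
      using Cs0_bounded[OF \<Omega>(2) u] by blast
    then have "\<forall>x\<in>\<Omega>. - B \<le> ?q u x"
      by (meson abs_le_D2 minus_le_iff)
    then have "bdd_below (?q u ` \<Omega>)"
      by (intro bdd_belowI2[of _ "-B"]) blast
    then have ge: "c \<le> ?q u x" if "x \<in> \<Omega>" for x
      unfolding c_def using that by (rule cINF_lower)
    have pos: "w \<in> Cs0_nonneg s \<Omega>"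
      if w: "w \<in> Cs0 s \<Omega>" and lt: "Cs0_norm s \<Omega> (\<lambda>x. w x - u x) < c" for w
    proof -
      obtain B' where "\<forall>x\<in>\<Omega>. \<bar>?q (\<lambda>x. w x - u x) x\<bar> \<le> B'"
        using Cs0_bounded[OF \<Omega>(2) Cs0_diff[OF w u]] by blast
      then have bdd: "bdd_above ((\<lambda>x. \<bar>?q (\<lambda>x. w x - u x) x\<bar>) ` \<Omega>)"
        by (intro bdd_aboveI2[of _ _ B']) auto
      have "0 \<le> w x" if x: "x \<in> \<Omega>" for x
      proof -
        have "\<bar>?q (\<lambda>x. w x - u x) x\<bar> < c"
          using cSUP_upper[OF x bdd] lt unfolding Cs0_norm_def by linarith
        then have "0 < ?q w x"
          using ge[OF x] by (simp add: diff_divide_distrib abs_less_iff)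
        then show ?thesis
          using dpos[OF x] by (simp add: zero_less_divide_iff)
      qed
      then show ?thesis
        using w nonneg_closure[of \<Omega> w] unfolding Cs0_nonneg_def Cs0_def by auto
    qed
    have "Cs0_norm s \<Omega> (\<lambda>x. u x - u x) = 0"
      unfolding Cs0_norm_def using \<Omega>(3) by simp
    then have "u \<in> Cs0_nonneg s \<Omega>"
      using pos[OF u] c by simp
    then show "u \<in> int_Cs0_nonneg s \<Omega>"
      unfolding int_Cs0_nonneg_def using pos c by blast
  }
qed

end

theory Submission
  imports Defs
begin

text \<open>
  Let \<open>L\<close> be the fractional \<open>p\<close>-Laplacian. The theorem follows from a stronger fact,
  \<open>comparison_with_dilation\<close>: there is \<open>\<eta> > 1\<close> with \<open>\<eta> v \<le> u\<close> throughout \<open>\<Omega>\<close>. As \<open>v > 0\<close>, this gives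
  \<open>u > v\<close>; and as \<open>u - v \<ge> (\<eta> - 1) v\<close>, it lets \<open>u - v\<close> inherit from \<open>v\<close> a positive lower bound for
  the quotient by the \<open>s\<close>-th power of the distance (\<open>int_Cs0_nonneg_diff\<close>).

  The reason why such an \<open>\<eta>\<close> exists is the nonlocality of \<open>L\<close>. By continuity \<open>u\<close> is larger than \<open>v\<close> by a
  fixed amount on some ball \<open>B\<close>. Comparing \<open>u\<close> with \<open>\<eta> v\<close> by means of the test function
  \<open>\<phi> = max 0 (\<eta> v - u)\<close>, every point where \<open>\<phi> > 0\<close> interacts with all of \<open>B\<close>, and this yields
  \<open>\<langle>L (\<eta> v) - L u, \<phi>\<rangle> \<ge> c \<integral> \<phi>\<close> with \<open>c > 0\<close> independent of \<open>\<eta>\<close> near \<open>1\<close> (\<open>frac_plap_diff_ge\<close>, based on the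
  quantitative monotonicity \<open>signed_powr_gap\<close>). On the other hand the hypotheses say that
  \<open>L v + g(v) \<le> L u + g(u) \<le> K\<close>, and \<open>L\<close> is homogeneous of degree \<open>p - 1\<close>, so \<open>L (\<eta> v) - L u\<close>
  exceeds \<open>g(u) - g(v)\<close> only by an error that tends to \<open>0\<close> as \<open>\<eta>\<close> tends to \<open>1\<close>; and \<open>g(u) - g(v)\<close>
  itself tends to \<open>0\<close> uniformly where \<open>\<phi> > 0\<close>, because there \<open>v \<le> u < \<eta> v\<close>. Both estimates together
  force \<open>\<integral> \<phi> = 0\<close> for \<open>\<eta>\<close> close enough to \<open>1\<close>, that is, \<open>\<eta> v \<le> u\<close>.
\<close>

section \<open>The odd power function of the fractional \<open>p\<close>-Laplacian\<close>

definition signed_powr :: "real \<Rightarrow> real \<Rightarrow> real" where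
  "signed_powr q t = \<bar>t\<bar> powr q * t"

text \<open>Since \<^term>\<open>b powr q \<le> a powr q\<close>, the difference is at least \<^term>\<open>a powr q * (a - b)\<close>.\<close>
lemma signed_powr_gap_nonneg:
  assumes "0 \<le> q" "0 \<le> b" "0 \<le> e" "b + e \<le> a"
  shows "e powr (q + 1) \<le> signed_powr q a - signed_powr q b"
proof (cases "e = 0")
  case True
  have "b powr q * b \<le> a powr q * a"
    using assms by (intro mult_mono powr_mono2) auto
  then show ?thesis using assms True by (simp add: signed_powr_def)
next
  case False
  have "e powr (q + 1) = e powr q * e"
    using assms False by (simp add: powr_add)
  also have "\<dots> \<le> a powr q * (a - b)"
    using assms by (intro mult_mono powr_mono2) auto
  also have "\<dots> = a powr q * a - a powr q * b"
    by (simp add: right_diff_distrib)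
  also have "\<dots> \<le> a powr q * a - b powr q * b"
    using assms by (simp add: mult_right_mono powr_mono2)
  finally show ?thesis using assms by (simp add: signed_powr_def)
qed

lemma signed_powr_minus: "signed_powr q (- t) = - signed_powr q t"
  by (simp add: signed_powr_def)

lemma signed_powr_nonneg: "0 \<le> t \<Longrightarrow> 0 \<le> signed_powr q t"
  by (simp add: signed_powr_def)

text \<open>
  The quantitative monotonicity that drives the comparison. If \<open>a\<close> and \<open>b\<close> have the same sign, oddness
  reduces it to the previous bound; if they have opposite signs, one of \<open>a\<close> and \<open>- b\<close> is at least
  \<open>e / 2\<close>, which is where the factor \<open>1 / 2\<close> comes from.
\<close>
lemma signed_powr_gap:
  assumes q: "0 \<le> q" and e: "0 \<le> e" and ab: "b + e \<le> a"
  shows "(e / 2) powr (q + 1) \<le> signed_powr q a - signed_powr q b"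
proof -
  have half: "(e / 2) powr (q + 1) \<le> e powr (q + 1)"
    using q e by (intro powr_mono2) auto
  have large: "(e / 2) powr (q + 1) \<le> signed_powr q t" if "e / 2 \<le> t" for t
    using signed_powr_gap_nonneg[of q 0 "e/2" t] q e that by (simp add: signed_powr_def)
  consider "0 \<le> b" | "a \<le> 0" | "b < 0" "0 < a" by linarith
  then show ?thesis
  proof cases
    case 1
    then show ?thesis
      using signed_powr_gap_nonneg[OF q 1 e ab] half by linarith
  next
    case 2
    then show ?thesis
      using signed_powr_gap_nonneg[OF q, of "- a" e "- b"] half e ab
      by (simp add: signed_powr_minus)
  next
    case 3
    have "0 \<le> signed_powr q a" "0 \<le> - signed_powr q b"
      using signed_powr_nonneg[of a q] signed_powr_nonneg[of "-b" q] 3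
      by (auto simp: signed_powr_minus)
    moreover have "e / 2 \<le> a \<or> e / 2 \<le> - b" using ab by linarith
    ultimately show ?thesis
      using large[of a] large[of "- b"] by (auto simp: signed_powr_minus)
  qed
qed

lemma signed_powr_mono:
  assumes "0 \<le> q" "b \<le> a"
  shows "signed_powr q b \<le> signed_powr q a"
  using signed_powr_gap[of q 0 b a] assms by simp

lemma signed_powr_mult:
  assumes "0 \<le> c"
  shows "signed_powr q (c * t) = c powr (q + 1) * signed_powr q t"
  using assms by (cases "c = 0") (auto simp: signed_powr_def abs_mult powr_mult powr_add)

text \<open>
  A crude form of Young's inequality, with both factors replaced by the larger one. It makes the pairing
  absolutely convergent on \<^const>\<open>Wsp\<close>.
\<close>
lemma abs_signed_powr_mult_le:
  assumes "0 \<le> q"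
  shows "\<bar>signed_powr q a * c\<bar> \<le> \<bar>a\<bar> powr (q + 2) + \<bar>c\<bar> powr (q + 2)"
proof -
  define m where "m = max \<bar>a\<bar> \<bar>c\<bar>"
  have "\<bar>signed_powr q a * c\<bar> = \<bar>a\<bar> powr q * \<bar>a\<bar> * \<bar>c\<bar>"
    by (simp add: signed_powr_def abs_mult)
  also have "\<dots> \<le> m powr q * m * m"
    using assms by (intro mult_mono powr_mono2) (auto simp: m_def)
  also have "\<dots> = m powr (q + 2)"
  proof (cases "m = 0")
    case False
    then have "0 < m" by (auto simp: m_def)
    then show ?thesis by (simp add: powr_add power2_eq_square)
  qed simp
  also have "\<dots> \<le> \<bar>a\<bar> powr (q + 2) + \<bar>c\<bar> powr (q + 2)"
    by (auto simp: m_def max_def)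
  finally show ?thesis .
qed

text \<open>Both factors have the sign of \<^term>\<open>f - h\<close>.\<close>
lemma signed_powr_diff_mult_pos_part_nonneg:
  assumes "0 \<le> q" "a - b = f - h"
  shows "0 \<le> (signed_powr q a - signed_powr q b) * (max 0 f - max 0 h)"
proof (cases "h \<le> f")
  case True
  then show ?thesis
    using assms signed_powr_mono[of q b a] by (intro mult_nonneg_nonneg) auto
next
  case False
  then show ?thesis
    using assms signed_powr_mono[of q a b] by (intro mult_nonpos_nonpos) auto
qed

section \<open>Lebesgue measure on a product of Euclidean spaces\<close>

text \<open>
  The measure \<^const>\<open>lebesgue\<close> on \<open>'a \<times> 'b\<close> is the completion of the product of the Borel measures, so
  measurability and almost-everywhere statements in one variable do not transfer through
  \<open>\<Otimes>\<^sub>M\<close> directly. They transfer because cylinders over null sets are null.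
\<close>
lemma null_cylinder_fst:
  fixes N :: "'a::euclidean_space set"
  assumes "N \<in> null_sets lborel"
  shows "N \<times> (UNIV :: 'b::euclidean_space set) \<in> null_sets lborel"
proof -
  have "N \<times> (UNIV :: 'b set) \<in> null_sets (lborel \<Otimes>\<^sub>M lborel)"
    using assms lborel.emeasure_pair_measure_Times[of N lborel "UNIV :: 'b set"]
    by (auto simp: null_sets_def)
  then show ?thesis by (simp add: lborel_prod)
qed

lemma null_cylinder_snd:
  fixes N :: "'a::euclidean_space set"
  assumes "N \<in> null_sets lborel"
  shows "(UNIV :: 'b::euclidean_space set) \<times> N \<in> null_sets lborel"
proof -
  have "(UNIV :: 'b set) \<times> N \<in> null_sets (lborel \<Otimes>\<^sub>M lborel)"
    using assms lborel.emeasure_pair_measure_Times[of "UNIV :: 'b set" lborel N]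
    by (auto simp: null_sets_def)
  then show ?thesis by (simp add: lborel_prod)
qed

lemma measurable_fst_lebesgue:
  "fst \<in> (lebesgue :: ('a::euclidean_space \<times> 'b::euclidean_space) measure) \<rightarrow>\<^sub>M lebesgue"
proof (rule completion.measurable_completion2)
  show meas: "fst \<in> (lebesgue :: ('a \<times> 'b) measure) \<rightarrow>\<^sub>M lborel"
    using measurable_fst[of "borel :: 'a measure" "borel :: 'b measure"]
    by (intro measurable_completion) (simp add: borel_prod)
  show "null_sets lborel \<subseteq> null_sets (distr (lebesgue :: ('a \<times> 'b) measure) lborel fst)"
  proof
    fix N :: "'a set" assume N: "N \<in> null_sets lborel"
    have "fst -` N = N \<times> (UNIV :: 'b set)" by auto
    then show "N \<in> null_sets (distr (lebesgue :: ('a \<times> 'b) measure) lborel fst)"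
      using N null_cylinder_fst[OF N, where 'b = 'b] meas
      by (auto simp: null_sets_def emeasure_distr)
  qed
qed

lemma measurable_snd_lebesgue:
  "snd \<in> (lebesgue :: ('b::euclidean_space \<times> 'a::euclidean_space) measure) \<rightarrow>\<^sub>M lebesgue"
proof (rule completion.measurable_completion2)
  show meas: "snd \<in> (lebesgue :: ('b \<times> 'a) measure) \<rightarrow>\<^sub>M lborel"
    using measurable_snd[of "borel :: 'b measure" "borel :: 'a measure"]
    by (intro measurable_completion) (simp add: borel_prod)
  show "null_sets lborel \<subseteq> null_sets (distr (lebesgue :: ('b \<times> 'a) measure) lborel snd)"
  proof
    fix N :: "'a set" assume N: "N \<in> null_sets lborel"
    have "snd -` N = (UNIV :: 'b set) \<times> N" by auto
    then show "N \<in> null_sets (distr (lebesgue :: ('b \<times> 'a) measure) lborel snd)"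
      using N null_cylinder_snd[OF N, where 'b = 'b] meas
      by (auto simp: null_sets_def emeasure_distr)
  qed
qed

lemma AE_lebesgue_fst:
  assumes "AE x in (lebesgue :: 'a::euclidean_space measure). P x"
  shows "AE z in (lebesgue :: ('a \<times> 'b::euclidean_space) measure). P (fst z)"
proof (rule AE_completion)
  have "AE x in lborel. P x"
    using assms by (simp add: AE_completion_iff)
  then obtain N where N: "N \<in> null_sets lborel" "{x. \<not> P x} \<subseteq> N"
    unfolding eventually_ae_filter by auto
  then have "{z. \<not> P (fst z)} \<subseteq> N \<times> (UNIV :: 'b set)" by auto
  then show "AE z in (lborel :: ('a \<times> 'b) measure). P (fst z)"
    by (intro AE_I'[OF null_cylinder_fst[OF N(1)]]) simp
qed

lemma AE_lebesgue_snd: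
  assumes "AE x in (lebesgue :: 'a::euclidean_space measure). P x"
  shows "AE z in (lebesgue :: ('b::euclidean_space \<times> 'a) measure). P (snd z)"
proof (rule AE_completion)
  have "AE x in lborel. P x"
    using assms by (simp add: AE_completion_iff)
  then obtain N where N: "N \<in> null_sets lborel" "{x. \<not> P x} \<subseteq> N"
    unfolding eventually_ae_filter by auto
  then have "{z. \<not> P (snd z)} \<subseteq> (UNIV :: 'b set) \<times> N" by auto
  then show "AE z in (lborel :: ('b \<times> 'a) measure). P (snd z)"
    by (intro AE_I'[OF null_cylinder_snd[OF N(1)]]) simp
qed

lemma lebesgue_tensor_product:
  fixes a :: "'a::euclidean_space \<Rightarrow> real" and b :: "'b::euclidean_space \<Rightarrow> real"
  assumes a: "integrable lborel a" and b: "integrable lborel b"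
  shows integrable_lebesgue_tensor: "integrable lebesgue (\<lambda>(x, y). a x * b y)"
    and integral_lebesgue_tensor:
      "(\<integral>(x, y). a x * b y \<partial>lebesgue) = (\<integral>x. a x \<partial>lborel) * (\<integral>y. b y \<partial>lborel)"
proof -
  have [measurable]: "a \<in> borel_measurable lborel" "b \<in> borel_measurable lborel"
    using a b by auto
  have int: "integrable (lborel \<Otimes>\<^sub>M lborel) (\<lambda>(x, y). a x * b y)"
  proof (rule lborel_pair.Fubini_integrable)
    show "integrable lborel (\<lambda>x. \<integral>y. norm (case (x, y) of (x, y) \<Rightarrow> a x * b y) \<partial>lborel)"
      using a b by (simp add: abs_mult)
    show "AE x in lborel. integrable lborel (\<lambda>y. case (x, y) of (x, y) \<Rightarrow> a x * b y)"
      using b by simp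
  qed measurable
  then have int': "integrable lborel (\<lambda>(x, y). a x * b y)"
    by (simp add: lborel_prod)
  then have meas: "(\<lambda>(x, y). a x * b y) \<in> borel_measurable lborel"
    by blast
  show "integrable lebesgue (\<lambda>(x, y). a x * b y)"
    using int' meas by (simp add: integrable_completion)
  have "(\<integral>x. \<integral>y. a x * b y \<partial>lborel \<partial>lborel) = (\<integral>(x, y). a x * b y \<partial>(lborel \<Otimes>\<^sub>M lborel))"
    by (rule lborel_pair.integral_fst[OF int])
  then show "(\<integral>(x, y). a x * b y \<partial>lebesgue) = (\<integral>x. a x \<partial>lborel) * (\<integral>y. b y \<partial>lborel)"
    using meas by (simp add: lborel_prod integral_completion)
qed

section \<open>The Gagliardo energy and the pairing\<close>

definition pairing_integrand ::
  "real \<Rightarrow> real \<Rightarrow> ('a::euclidean_space \<Rightarrow> real) \<Rightarrow> ('a \<Rightarrow> real) \<Rightarrow> 'a \<times> 'a \<Rightarrow> real" where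
  "pairing_integrand s p u \<phi> z =
    signed_powr (p - 2) (u (fst z) - u (snd z)) * (\<phi> (fst z) - \<phi> (snd z))
      / norm (fst z - snd z) powr (real DIM('a) + p * s)"

lemma frac_plap_eq_integral: "frac_plap s p u \<phi> = (\<integral>z. pairing_integrand s p u \<phi> z \<partial>lebesgue)"
  unfolding frac_plap_def pairing_integrand_def signed_powr_def by (simp add: case_prod_unfold)

definition gagliardo_integrand ::
  "real \<Rightarrow> real \<Rightarrow> ('a::euclidean_space \<Rightarrow> real) \<Rightarrow> 'a \<times> 'a \<Rightarrow> real" where
  "gagliardo_integrand s p u z =
    \<bar>u (fst z) - u (snd z)\<bar> powr p / norm (fst z - snd z) powr (real DIM('a) + p * s)"

lemma gagliardo_integrand_nonneg: "0 \<le> gagliardo_integrand s p u z"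
  by (simp add: gagliardo_integrand_def)

lemma borel_measurable_kernel:
  "(\<lambda>z :: 'a::euclidean_space \<times> 'a. norm (fst z - snd z) powr r) \<in> borel_measurable lebesgue"
proof -
  have "(\<lambda>z :: 'a \<times> 'a. norm (fst z - snd z)) \<in> borel_measurable borel"
    by (intro borel_measurable_continuous_onI continuous_intros)
  then have "(\<lambda>z :: 'a \<times> 'a. norm (fst z - snd z)) \<in> borel_measurable lebesgue"
    by (simp add: measurable_completion)
  then show ?thesis by measurable
qed

lemma borel_measurable_gagliardo_integrand:
  assumes "u \<in> borel_measurable lebesgue"
  shows "gagliardo_integrand s p u \<in> borel_measurable lebesgue"
proof -
  note [measurable] = measurable_compose[OF measurable_fst_lebesgue assms]
    measurable_compose[OF measurable_snd_lebesgue assms] borel_measurable_kernel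
  show ?thesis unfolding gagliardo_integrand_def by measurable
qed

lemma borel_measurable_pairing_integrand:
  assumes "u \<in> borel_measurable lebesgue" "\<phi> \<in> borel_measurable lebesgue"
  shows "pairing_integrand s p u \<phi> \<in> borel_measurable lebesgue"
proof -
  note [measurable] = measurable_compose[OF measurable_fst_lebesgue assms(1)]
    measurable_compose[OF measurable_snd_lebesgue assms(1)]
    measurable_compose[OF measurable_fst_lebesgue assms(2)]
    measurable_compose[OF measurable_snd_lebesgue assms(2)] borel_measurable_kernel
  show ?thesis unfolding pairing_integrand_def signed_powr_def by measurable
qed

lemma gagliardo_pow_finite_iff:
  assumes "u \<in> borel_measurable lebesgue"
  shows "gagliardo_pow s p u < \<infinity> \<longleftrightarrow> integrable lebesgue (gagliardo_integrand s p u)"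
  unfolding integrable_iff_bounded gagliardo_pow_def
  using borel_measurable_gagliardo_integrand[OF assms]
  by (simp add: gagliardo_integrand_def case_prod_unfold)

lemma WspD:
  assumes "u \<in> Wsp s p"
  shows "u \<in> borel_measurable lebesgue" "integrable lebesgue (\<lambda>x. \<bar>u x\<bar> powr p)"
    "integrable lebesgue (gagliardo_integrand s p u)"
  using assms gagliardo_pow_finite_iff[of u s p] by (auto simp: Wsp_def)

lemma integrable_pairing_integrand:
  assumes "2 \<le> p" "u \<in> Wsp s p" "\<phi> \<in> Wsp s p"
  shows "integrable lebesgue (pairing_integrand s p u \<phi>)"
proof (rule Bochner_Integration.integrable_bound)
  show "integrable lebesgue (\<lambda>z. gagliardo_integrand s p u z + gagliardo_integrand s p \<phi> z)"
    using assms by (intro Bochner_Integration.integrable_add WspD)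
  show "pairing_integrand s p u \<phi> \<in> borel_measurable lebesgue"
    using assms by (intro borel_measurable_pairing_integrand WspD)
  show "AE z in lebesgue. norm (pairing_integrand s p u \<phi> z)
      \<le> norm (gagliardo_integrand s p u z + gagliardo_integrand s p \<phi> z)"
  proof (rule AE_I2)
    fix z :: "'a \<times> 'a"
    have "\<bar>signed_powr (p - 2) (u (fst z) - u (snd z)) * (\<phi> (fst z) - \<phi> (snd z))\<bar>
        \<le> \<bar>u (fst z) - u (snd z)\<bar> powr p + \<bar>\<phi> (fst z) - \<phi> (snd z)\<bar> powr p"
      using abs_signed_powr_mult_le[of "p - 2"] assms(1) by simp
    then have "\<bar>pairing_integrand s p u \<phi> z\<bar>
        \<le> gagliardo_integrand s p u z + gagliardo_integrand s p \<phi> z"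
      unfolding pairing_integrand_def gagliardo_integrand_def
      by (simp add: divide_right_mono flip: add_divide_distrib)
    then show "norm (pairing_integrand s p u \<phi> z)
        \<le> norm (gagliardo_integrand s p u z + gagliardo_integrand s p \<phi> z)"
      by simp
  qed
qed

lemma frac_plap_scale:
  fixes u :: "'a::euclidean_space \<Rightarrow> real"
  assumes "0 \<le> c"
  shows "frac_plap s p (\<lambda>x. c * u x) \<phi> = c powr (p - 1) * frac_plap s p u \<phi>"
proof -
  have "pairing_integrand s p (\<lambda>x. c * u x) \<phi> z = c powr (p - 1) * pairing_integrand s p u \<phi> z" for z
    using signed_powr_mult[OF assms, of "p - 2" "u (fst z) - u (snd z)"]
    by (simp add: pairing_integrand_def flip: right_diff_distrib)
  then show ?thesis by (simp add: frac_plap_eq_integral)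
qed

lemma powr_triangle:
  fixes a b c p :: real
  assumes "0 \<le> p" "\<bar>c\<bar> \<le> \<bar>a\<bar> + \<bar>b\<bar>"
  shows "\<bar>c\<bar> powr p \<le> 2 powr p * (\<bar>a\<bar> powr p + \<bar>b\<bar> powr p)"
proof -
  have "\<bar>c\<bar> powr p \<le> (2 * max \<bar>a\<bar> \<bar>b\<bar>) powr p"
    using assms by (intro powr_mono2) auto
  also have "\<dots> = 2 powr p * max \<bar>a\<bar> \<bar>b\<bar> powr p"
    by (simp add: powr_mult)
  also have "\<dots> \<le> 2 powr p * (\<bar>a\<bar> powr p + \<bar>b\<bar> powr p)"
    by (intro mult_left_mono) (auto simp: max_def)
  finally show ?thesis .
qed

text \<open>
  Membership in \<^const>\<open>Wsp\<close> only depends on the sizes of the values and of the increments. The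
  test function of the comparison argument, a truncation of a linear combination of two
  elements, is controlled in this way.
\<close>
lemma Wsp_dominated:
  fixes \<phi> :: "'a::euclidean_space \<Rightarrow> real"
  assumes p: "0 \<le> p" and w: "w \<in> Wsp s p" and u: "u \<in> Wsp s p"
    and \<phi>: "\<phi> \<in> borel_measurable lebesgue"
    and size: "AE x in lebesgue. \<bar>\<phi> x\<bar> \<le> \<bar>w x\<bar> + \<bar>u x\<bar>"
    and incr: "AE z in lebesgue. \<bar>\<phi> (fst z) - \<phi> (snd z)\<bar>
        \<le> \<bar>w (fst z) - w (snd z)\<bar> + \<bar>u (fst z) - u (snd z)\<bar>"
  shows "\<phi> \<in> Wsp s p"
proof -
  have "integrable lebesgue (\<lambda>x. \<bar>\<phi> x\<bar> powr p)"
  proof (rule Bochner_Integration.integrable_bound)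
    show "integrable lebesgue (\<lambda>x. 2 powr p * (\<bar>w x\<bar> powr p + \<bar>u x\<bar> powr p))"
      using WspD(2)[OF w] WspD(2)[OF u] by simp
    show "(\<lambda>x. \<bar>\<phi> x\<bar> powr p) \<in> borel_measurable lebesgue"
      using \<phi> by measurable
    show "AE x in lebesgue. norm (\<bar>\<phi> x\<bar> powr p) \<le> norm (2 powr p * (\<bar>w x\<bar> powr p + \<bar>u x\<bar> powr p))"
      using size by eventually_elim (use powr_triangle[OF p] in simp)
  qed
  moreover have "integrable lebesgue (gagliardo_integrand s p \<phi>)"
  proof (rule Bochner_Integration.integrable_bound)
    show "integrable lebesgue (\<lambda>z. 2 powr p * (gagliardo_integrand s p w z + gagliardo_integrand s p u z))"
      using WspD(3)[OF w] WspD(3)[OF u] by simp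
    show "gagliardo_integrand s p \<phi> \<in> borel_measurable lebesgue"
      using \<phi> by (rule borel_measurable_gagliardo_integrand)
    show "AE z in lebesgue. norm (gagliardo_integrand s p \<phi> z)
        \<le> norm (2 powr p * (gagliardo_integrand s p w z + gagliardo_integrand s p u z))"
      using incr
    proof eventually_elim
      case (elim z)
      show ?case
        using divide_right_mono[OF powr_triangle[OF p elim],
            of "norm (fst z - snd z) powr (real DIM('a) + p * s)"]
        gagliardo_integrand_nonneg[of s p w z] gagliardo_integrand_nonneg[of s p u z]
        by (simp add: gagliardo_integrand_def add_divide_distrib distrib_left)
    qed
  qed
  ultimately show ?thesis
    using \<phi> gagliardo_pow_finite_iff[OF \<phi>, of s p] by (simp add: Wsp_def)
qed

lemma Wsp_scale:
  assumes "u \<in> Wsp s p"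
  shows "(\<lambda>x. c * u x) \<in> Wsp s p"
proof -
  have "gagliardo_integrand s p (\<lambda>x. c * u x) = (\<lambda>z. \<bar>c\<bar> powr p * gagliardo_integrand s p u z)"
    by (rule ext) (simp add: gagliardo_integrand_def abs_mult powr_mult flip: right_diff_distrib)
  then show ?thesis
    using WspD[OF assms] gagliardo_pow_finite_iff[of "\<lambda>x. c * u x" s p]
    by (simp add: Wsp_def abs_mult powr_mult)
qed

section \<open>A lower bound from the nonlocal interaction\<close>

text \<open>
  Write \<open>\<phi> = max 0 (w - u)\<close>. The integrand of the difference of the two pairings is nonnegative
  almost everywhere, so it may be bounded below on the pairs \<open>(x, y)\<close> with \<open>y\<close> in \<open>B\<close> alone. If moreover
  \<open>\<phi> x > 0\<close>, then \<open>\<phi> y = 0\<close> and \<open>w x - w y\<close> exceeds \<open>u x - u y\<close> by at least \<open>e\<close>, while the kernel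
  is bounded below because \<open>x\<close> and \<open>y\<close> lie at distance at most \<open>d\<close>. The points of \<open>B\<close> thus contribute
  at every point \<open>x\<close> of \<open>\<Omega>\<close> in proportion to \<open>\<phi> x\<close>, however far \<open>B\<close> is: this is the nonlocal effect.
  The constant depends on \<open>w\<close> and \<open>u\<close> only through \<open>e\<close> and \<open>B\<close>.
\<close>
lemma frac_plap_diff_ge:
  fixes w u \<phi> :: "'a::euclidean_space \<Rightarrow> real" and B \<Omega> :: "'a set"
  assumes p: "2 \<le> p" and s: "0 \<le> s" and e: "0 \<le> e" and d: "0 < d"
    and w: "w \<in> Wsp s p" and u: "u \<in> Wsp s p" and \<phi>: "\<phi> \<in> Wsp s p"
    and int: "integrable lborel \<phi>"
    and pos: "AE x in lebesgue. \<phi> x = max 0 (w x - u x)"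
    and supp: "\<And>x. x \<notin> \<Omega> \<Longrightarrow> \<phi> x = 0"
    and B: "B \<in> sets borel" "emeasure lborel B < \<infinity>"
    and gap: "AE y in lebesgue. y \<in> B \<longrightarrow> w y + e \<le> u y"
    and diam: "\<And>x y. x \<in> \<Omega> \<Longrightarrow> y \<in> B \<Longrightarrow> norm (x - y) \<le> d"
  shows "(e / 2) powr (p - 1) / d powr (real DIM('a) + p * s) * measure lborel B * (\<integral>x. \<phi> x \<partial>lborel)
    \<le> frac_plap s p w \<phi> - frac_plap s p u \<phi>"
proof -
  define C where "C = (e / 2) powr (p - 1) / d powr (real DIM('a) + p * s)"
  have indB: "integrable lborel (indicator B :: 'a \<Rightarrow> real)"
    using B by (simp add: integrable_indicator_iff)
  have C\<phi>: "integrable lborel (\<lambda>x. C * \<phi> x)"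
    using int by simp
  have "C * (\<integral>x. \<phi> x \<partial>lborel) * measure lborel B
      = (\<integral>(x, y). (C * \<phi> x) * indicator B y \<partial>lebesgue)"
    using B integral_lebesgue_tensor[OF C\<phi> indB] by simp
  also have "\<dots> \<le> (\<integral>z. pairing_integrand s p w \<phi> z - pairing_integrand s p u \<phi> z \<partial>lebesgue)"
  proof (rule integral_mono_AE)
    show "integrable lebesgue (\<lambda>(x, y). (C * \<phi> x) * indicator B y :: real)"
      by (rule integrable_lebesgue_tensor[OF C\<phi> indB])
    show "integrable lebesgue (\<lambda>z. pairing_integrand s p w \<phi> z - pairing_integrand s p u \<phi> z)"
      using p w u \<phi> by (intro Bochner_Integration.integrable_diff integrable_pairing_integrand)
    show "AE z in lebesgue. (case z of (x, y) \<Rightarrow> (C * \<phi> x) * indicator B y)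
        \<le> pairing_integrand s p w \<phi> z - pairing_integrand s p u \<phi> z"
      using AE_lebesgue_fst[OF pos, where 'b = 'a] AE_lebesgue_snd[OF pos, where 'b = 'a]
        AE_lebesgue_snd[OF gap, where 'b = 'a]
    proof eventually_elim
      case (elim z)
      obtain x y where z: "z = (x, y)" by (cases z)
      let ?k = "norm (x - y) powr (real DIM('a) + p * s)"
      let ?J = "signed_powr (p - 2) (w x - w y) - signed_powr (p - 2) (u x - u y)"
      have "0 \<le> ?J * (max 0 (w x - u x) - max 0 (w y - u y))"
        using p by (intro signed_powr_diff_mult_pos_part_nonneg) auto
      then have J0: "0 \<le> ?J * (\<phi> x - \<phi> y)"
        using elim z by simp
      have eq: "pairing_integrand s p w \<phi> z - pairing_integrand s p u \<phi> z = ?J * (\<phi> x - \<phi> y) / ?k"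
        by (simp add: pairing_integrand_def z left_diff_distrib diff_divide_distrib)
      show ?case
      proof (cases "y \<in> B \<and> \<phi> x \<noteq> 0")
        case False
        then have "(case z of (x, y) \<Rightarrow> (C * \<phi> x) * indicator B y) = 0"
          by (auto simp: z indicator_def)
        moreover have "0 \<le> ?J * (\<phi> x - \<phi> y) / ?k"
          using J0 by (rule divide_nonneg_nonneg) simp
        ultimately show ?thesis
          using eq by linarith
      next
        case True
        then have x: "x \<in> \<Omega>" and y: "y \<in> B" using supp by auto
        have wu: "\<phi> x = w x - u x" "0 < w x - u x" and yy: "w y + e \<le> u y" "\<phi> y = 0"
          using elim True y e z by auto
        have "x \<noteq> y" using True yy by auto
        then have k: "0 < ?k" "?k \<le> d powr (real DIM('a) + p * s)"
          using diam[OF x y] p s by (auto intro!: powr_mono2)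
        have "(e / 2) powr (p - 2 + 1) \<le> ?J"
          using p e wu yy by (intro signed_powr_gap) auto
        moreover have "p - 2 + 1 = p - 1" by simp
        ultimately have J: "(e / 2) powr (p - 1) \<le> ?J" by metis
        have "C \<le> ?J / ?k"
          unfolding C_def using J k d by (intro frac_le order.trans[OF _ J]) auto
        then have "C * \<phi> x \<le> ?J / ?k * \<phi> x"
          using wu by (intro mult_right_mono) auto
        then show ?thesis
          using y yy eq by (simp add: z)
      qed
    qed
  qed
  also have "\<dots> = frac_plap s p w \<phi> - frac_plap s p u \<phi>"
    using p w u \<phi> by (simp add: frac_plap_eq_integral integrable_pairing_integrand)
  finally show ?thesis by (simp add: C_def mult_ac)
qed

section \<open>Auxiliary facts on continuous functions\<close>

lemma nonpos_of_AE_nonpos: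
  fixes f :: "'a::euclidean_space \<Rightarrow> real"
  assumes "open \<Omega>" "continuous_on \<Omega> f" "AE x in lborel. x \<in> \<Omega> \<longrightarrow> f x \<le> 0" "x \<in> \<Omega>"
  shows "f x \<le> 0"
proof -
  define S where "S = \<Omega> \<inter> f -` {0<..}"
  have S: "open S"
    unfolding S_def using assms(1,2) by (intro continuous_open_preimage) auto
  have "AE x in lborel. x \<notin> S"
    using assms(3) by eventually_elim (auto simp: S_def)
  then have "S \<in> null_sets lborel"
    using S by (subst AE_iff_null_sets) auto
  then have "negligible S"
    by (simp add: negligible_iff_null_sets null_sets_completionI)
  then have "S = {}"
    using open_not_negligible[OF S] by blast
  then show ?thesis
    using assms(4) by (auto simp: S_def not_less[symmetric])
qed

lemma set_integrable_mult_continuous_bounded: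
  fixes h \<phi> :: "'a::euclidean_space \<Rightarrow> real"
  assumes "open \<Omega>" "continuous_on \<Omega> h" "\<And>x. x \<in> \<Omega> \<Longrightarrow> \<bar>h x\<bar> \<le> H" "integrable lborel \<phi>"
  shows "set_integrable lebesgue \<Omega> (\<lambda>x. h x * \<phi> x)"
  unfolding set_integrable_def
proof (rule Bochner_Integration.integrable_bound)
  have \<phi>: "\<phi> \<in> borel_measurable lborel"
    using assms(4) by auto
  have h: "(\<lambda>x. indicator \<Omega> x *\<^sub>R h x) \<in> borel_measurable lborel"
    using assms(1,2) borel_measurable_continuous_on_indicator[of \<Omega> h] by simp
  show "integrable lebesgue (\<lambda>x. H * \<phi> x)"
    using assms(4) \<phi> by (simp add: integrable_completion)
  have "(\<lambda>x. (indicator \<Omega> x *\<^sub>R h x) * \<phi> x) \<in> borel_measurable lborel"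
    using h \<phi> by (rule borel_measurable_times)
  then show "(\<lambda>x. indicator \<Omega> x *\<^sub>R (h x * \<phi> x)) \<in> borel_measurable lebesgue"
    by (intro measurable_completion) (simp add: mult.assoc)
  show "AE x in lebesgue. norm (indicator \<Omega> x *\<^sub>R (h x * \<phi> x)) \<le> norm (H * \<phi> x)"
  proof (rule AE_I2)
    fix x
    have "\<bar>h x * \<phi> x\<bar> \<le> \<bar>H * \<phi> x\<bar>" if "x \<in> \<Omega>"
      using assms(3)[OF that] by (simp add: abs_mult mult_right_mono)
    then show "norm (indicator \<Omega> x *\<^sub>R (h x * \<phi> x)) \<le> norm (H * \<phi> x)"
      by (simp add: indicator_def)
  qed
qed

lemma exists_dilation_factor:
  fixes K G M a b r :: real
  assumes "0 < a" "0 < b"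
  shows "\<exists>\<eta>>1. \<eta> powr r < 2 \<and> (\<eta> powr r - 1) * K < a \<and> (\<eta> - 1) * M < b"
proof -
  have 1: "((\<lambda>\<eta>. \<eta> powr r) \<longlongrightarrow> 1 powr r) (at_right (1::real))"
    by (intro tendsto_intros) auto
  have 2: "((\<lambda>\<eta>. (\<eta> powr r - 1) * K) \<longlongrightarrow> (1 powr r - 1) * K) (at_right (1::real))"
    by (intro tendsto_intros) auto
  have 3: "((\<lambda>\<eta>. (\<eta> - 1) * M) \<longlongrightarrow> (1 - 1) * M) (at_right (1::real))"
    by (intro tendsto_intros)
  have "\<forall>\<^sub>F \<eta> in at_right (1::real). 1 < \<eta>"
    by (rule eventually_at_right_less)
  moreover have "\<forall>\<^sub>F \<eta> in at_right (1::real). \<eta> powr r < 2"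
    by (rule order_tendstoD(2)[OF 1]) simp
  moreover have "\<forall>\<^sub>F \<eta> in at_right (1::real). (\<eta> powr r - 1) * K < a"
    by (rule order_tendstoD(2)[OF 2]) (use assms in simp)
  moreover have "\<forall>\<^sub>F \<eta> in at_right (1::real). (\<eta> - 1) * M < b"
    by (rule order_tendstoD(2)[OF 3]) (use assms in simp)
  ultimately have "\<forall>\<^sub>F \<eta> in at_right (1::real).
      1 < \<eta> \<and> \<eta> powr r < 2 \<and> (\<eta> powr r - 1) * K < a \<and> (\<eta> - 1) * M < b"
    by eventually_elim blast
  then show ?thesis
    using eventually_happens'[OF trivial_limit_at_right_real] by blast
qed

section \<open>Comparison with a dilation\<close>

text \<open>
  The test function is \<open>\<phi> = max 0 (\<eta> v - u)\<close>, and \<open>I\<close> is its integral. Where \<open>u > v + 2 e\<close>, which is the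
  case on some ball \<open>B\<close>, one still has \<open>u \<ge> \<eta> v + e\<close> for \<open>\<eta>\<close> near \<open>1\<close>, so the previous section bounds
  \<open>\<langle>L (\<eta> v) - L u, \<phi>\<rangle>\<close> from below by \<open>c I\<close> with \<open>c\<close> independent of \<open>\<eta>\<close>. By homogeneity and the two
  weak inequalities, with \<open>t = \<eta> powr (p - 1)\<close>, the same quantity is at most
  \<open>(t - 1) (K + G) I + t \<integral> (g(u) - g(v)) \<phi>\<close>, where \<open>G\<close> bounds \<open>\<bar>g\<bar>\<close> on the range of \<open>u\<close> and \<open>v\<close>.
  On the support of \<open>\<phi>\<close> the values of \<open>u\<close> and \<open>v\<close> are trapped in \<open>v \<le> u < \<eta> v\<close>, so the last integrand is
  small relative to \<open>\<phi>\<close> by uniform continuity of \<open>g\<close>. For \<open>\<eta>\<close> close to \<open>1\<close> the upper bound is less than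
  \<open>c I\<close> unless \<open>I = 0\<close>.
\<close>
proposition comparison_with_dilation:
  fixes \<Omega> :: "'a::euclidean_space set" and p s K :: real
    and g :: "real \<Rightarrow> real" and u v :: "'a \<Rightarrow> real"
  assumes \<Omega>: "open \<Omega>" "bounded \<Omega>" and p: "2 \<le> p" and s: "0 \<le> s"
    and g: "continuous_on UNIV g"
    and u: "u \<in> Wsp0 s p \<Omega>" "continuous_on (closure \<Omega>) u"
    and v: "v \<in> Wsp0 s p \<Omega>" "continuous_on (closure \<Omega>) v"
    and neq: "\<exists>x\<in>\<Omega>. u x \<noteq> v x" and K: "0 \<le> K"
    and weak: "\<forall>\<phi>\<in>Wsp0_nonneg s p \<Omega>.
           frac_plap s p v \<phi> + (LINT x:\<Omega>|lebesgue. g (v x) * \<phi> x)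
             \<le> frac_plap s p u \<phi> + (LINT x:\<Omega>|lebesgue. g (u x) * \<phi> x) \<and>
           frac_plap s p u \<phi> + (LINT x:\<Omega>|lebesgue. g (u x) * \<phi> x)
             \<le> K * (LINT x:\<Omega>|lebesgue. \<phi> x)"
    and vu: "\<forall>x\<in>\<Omega>. 0 \<le> v x \<and> v x \<le> u x"
  shows "\<exists>\<eta>>1. \<forall>x\<in>\<Omega>. \<eta> * v x \<le> u x"
proof -
  have cu: "continuous_on \<Omega> u" and cv: "continuous_on \<Omega> v"
    using u(2) v(2) closure_subset continuous_on_subset by blast+
  have uW: "u \<in> Wsp s p" and u0: "AE x in lebesgue. x \<notin> \<Omega> \<longrightarrow> u x = 0"
    and vW: "v \<in> Wsp s p" and v0: "AE x in lebesgue. x \<notin> \<Omega> \<longrightarrow> v x = 0"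
    using u(1) v(1) by (auto simp: Wsp0_def)
  obtain x0 where x0: "x0 \<in> \<Omega>" "v x0 < u x0"
    using neq vu by force
  define e where "e = (u x0 - v x0) / 3"
  have e: "0 < e" using x0 by (simp add: e_def)
  have "open (\<Omega> \<inter> (\<lambda>x. u x - v x) -` {2 * e<..})"
    using cu cv \<Omega>(1) by (intro continuous_open_preimage continuous_intros) auto
  moreover have "x0 \<in> \<Omega> \<inter> (\<lambda>x. u x - v x) -` {2 * e<..}"
    using x0 by (auto simp: e_def)
  ultimately obtain r where r: "0 < r" "ball x0 r \<subseteq> \<Omega> \<inter> (\<lambda>x. u x - v x) -` {2 * e<..}"
    unfolding open_contains_ball by blast
  define B where "B = ball x0 r"
  have B\<Omega>: "B \<subseteq> \<Omega>" and Bgap: "\<And>y. y \<in> B \<Longrightarrow> 2 * e < u y - v y"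
    using r by (auto simp: B_def)
  have Bpos: "0 < measure lborel B"
    using content_ball_pos[OF r(1), of x0] by (simp add: B_def)
  have "compact (closure \<Omega>)" using \<Omega>(2) by simp
  then have "bounded (u ` closure \<Omega>)"
    using u(2) by (intro compact_imp_bounded compact_continuous_image)
  then obtain M where M: "0 < M" "\<And>x. x \<in> closure \<Omega> \<Longrightarrow> \<bar>u x\<bar> \<le> M"
    unfolding bounded_pos by auto
  have uM: "u x \<in> {0..M}" and vM: "v x \<in> {0..M}" if "x \<in> \<Omega>" for x
    using M(2)[of x] vu that closure_subset[of \<Omega>] by force+
  have gM: "continuous_on {0..M} g"
    using g continuous_on_subset by blast
  have "bounded (g ` {0..M})"
    using gM by (intro compact_imp_bounded compact_continuous_image) auto
  then obtain G where G: "0 < G" "\<And>t. t \<in> {0..M} \<Longrightarrow> \<bar>g t\<bar> \<le> G"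
    unfolding bounded_pos by auto
  define d where "d = diameter \<Omega> + 1"
  have d: "0 < d"
    using diameter_ge_0[OF \<Omega>(2)] by (simp add: d_def)
  have diam: "norm (x - y) \<le> d" if "x \<in> \<Omega>" "y \<in> B" for x y
    using diameter_bounded_bound[OF \<Omega>(2) that(1), of y] that B\<Omega> by (auto simp: d_def dist_norm)
  \<comment> \<open>The constant of \<open>frac_plap_diff_ge\<close>; it has to be fixed before \<open>\<eta>\<close>.\<close>
  define c where "c = (e / 2) powr (p - 1) / d powr (real DIM('a) + p * s) * measure lborel B"
  have c: "0 < c"
    using e d Bpos by (simp add: c_def)
  have "uniformly_continuous_on {0..M} g"
    using gM by (intro compact_uniformly_continuous) auto
  then obtain \<delta> where \<delta>: "0 < \<delta>"
      "\<And>t t'. t \<in> {0..M} \<Longrightarrow> t' \<in> {0..M} \<Longrightarrow> \<bar>t' - t\<bar> < \<delta> \<Longrightarrow> \<bar>g t' - g t\<bar> < c / 4"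
    using c unfolding uniformly_continuous_on_def dist_real_def
    by (metis divide_pos_pos zero_less_numeral)
  \<comment> \<open>The two upper-bound terms get \<open>c / 2\<close> each: the first is strictly less, the second at most \<open>2 * (c / 4)\<close>.\<close>
  obtain \<eta> where \<eta>: "1 < \<eta>" "\<eta> powr (p - 1) < 2"
      "(\<eta> powr (p - 1) - 1) * (K + G) < c / 2" "(\<eta> - 1) * M < min e \<delta>"
    using exists_dilation_factor[of "c / 2" "min e \<delta>" "p - 1" "K + G" M] c e \<delta>(1) by auto
  have dil: "(\<eta> - 1) * v x < min e \<delta>" if "x \<in> \<Omega>" for x
  proof -
    have "(\<eta> - 1) * v x \<le> (\<eta> - 1) * M"
      using \<eta>(1) vM[OF that] by (intro mult_left_mono) auto
    then show ?thesis using \<eta>(4) by linarith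
  qed
  \<comment> \<open>The indicator only changes the function on a null set and makes it Borel measurable:
    \<open>u\<close> and \<open>v\<close> vanish almost everywhere outside \<open>\<Omega>\<close>, but need not be Borel measurable there.\<close>
  define \<phi> where "\<phi> = (\<lambda>x. indicator \<Omega> x *\<^sub>R max 0 (\<eta> * v x - u x))"
  have \<phi>0: "0 \<le> \<phi> x" for x
    by (simp add: \<phi>_def)
  have \<phi>M: "\<phi> x \<le> e * indicator \<Omega> x" for x
  proof (cases "x \<in> \<Omega>")
    case True
    have "\<eta> * v x - u x \<le> (\<eta> - 1) * v x"
      using vu True by (simp add: left_diff_distrib)
    then show ?thesis
      using dil[OF True] e True by (simp add: \<phi>_def)
  qed (simp add: \<phi>_def)
  have "continuous_on \<Omega> (\<lambda>x. max 0 (\<eta> * v x - u x))"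
    using cu cv by (intro continuous_intros)
  then have "\<phi> \<in> borel_measurable borel"
    unfolding \<phi>_def using \<Omega>(1) by (intro borel_measurable_continuous_on_indicator) auto
  then have \<phi>meas: "\<phi> \<in> borel_measurable lborel"
    by simp
  have \<phi>int: "integrable lborel \<phi>"
  proof (rule Bochner_Integration.integrable_bound)
    show "integrable lborel (\<lambda>x. e * indicator \<Omega> x :: real)"
      using \<Omega> emeasure_bounded_finite[OF \<Omega>(2)] by (simp add: integrable_indicator_iff)
    show "AE x in lborel. norm (\<phi> x) \<le> norm (e * indicator \<Omega> x :: real)"
      using \<phi>0 \<phi>M e by (intro AE_I2) (simp add: abs_mult)
  qed (rule \<phi>meas)
  have \<phi>pos: "AE x in lebesgue. \<phi> x = max 0 (\<eta> * v x - u x)"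
    using u0 v0 by eventually_elim (auto simp: \<phi>_def indicator_def)
  have wW: "(\<lambda>x. \<eta> * v x) \<in> Wsp s p"
    using vW by (rule Wsp_scale)
  have \<phi>W: "\<phi> \<in> Wsp s p"
  proof (rule Wsp_dominated[OF _ wW uW])
    show "AE x in lebesgue. \<bar>\<phi> x\<bar> \<le> \<bar>\<eta> * v x\<bar> + \<bar>u x\<bar>"
      using \<phi>pos by eventually_elim auto
    show "AE z in lebesgue. \<bar>\<phi> (fst z) - \<phi> (snd z)\<bar>
        \<le> \<bar>\<eta> * v (fst z) - \<eta> * v (snd z)\<bar> + \<bar>u (fst z) - u (snd z)\<bar>"
      using AE_lebesgue_fst[OF \<phi>pos, where 'b = 'a] AE_lebesgue_snd[OF \<phi>pos, where 'b = 'a]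
      by eventually_elim (auto simp: max_def)
  qed (use p \<phi>meas in \<open>auto intro: measurable_completion\<close>)
  have \<phi>test: "\<phi> \<in> Wsp0_nonneg s p \<Omega>"
    using \<phi>W \<phi>0 by (auto simp: Wsp0_nonneg_def Wsp0_def \<phi>_def)
  define I where "I = (\<integral>x. \<phi> x \<partial>lborel)"
  have I0: "0 \<le> I"
    unfolding I_def using \<phi>0 by simp
  have I_eq: "(LINT x:\<Omega>|lebesgue. \<phi> x) = I"
  proof -
    have "(\<lambda>x. indicator \<Omega> x *\<^sub>R \<phi> x) = \<phi>"
      by (auto simp: \<phi>_def indicator_def)
    then show ?thesis
      using \<phi>meas by (simp add: set_lebesgue_integral_def I_def integral_completion)
  qed
  have \<phi>set: "set_integrable lebesgue \<Omega> (\<lambda>x. b * \<phi> x)" for b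
    using \<Omega>(1) \<phi>int by (intro set_integrable_mult_continuous_bounded[where H = "\<bar>b\<bar>"]) auto
  have guint: "set_integrable lebesgue \<Omega> (\<lambda>x. g (u x) * \<phi> x)"
    and gvint: "set_integrable lebesgue \<Omega> (\<lambda>x. g (v x) * \<phi> x)"
    using \<Omega>(1) \<phi>int G(2) uM vM cu cv g
    by (auto intro!: set_integrable_mult_continuous_bounded[where H = G] continuous_on_compose2[OF g])
  define Fu Fv A U where "Fu = frac_plap s p u \<phi>" and "Fv = frac_plap s p v \<phi>"
    and "A = (LINT x:\<Omega>|lebesgue. g (v x) * \<phi> x)" and "U = (LINT x:\<Omega>|lebesgue. g (u x) * \<phi> x)"
  have weak1: "Fv + A \<le> Fu + U" and weak2: "Fu + U \<le> K * I"
    using weak \<phi>test I_eq by (auto simp: Fu_def Fv_def A_def U_def)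
  have U_ge: "- G * I \<le> U"
  proof -
    have "- G * I = (LINT x:\<Omega>|lebesgue. - G * \<phi> x)"
      using I_eq by (simp only: set_integral_mult_right)
    also have "\<dots> \<le> U"
      unfolding U_def
    proof (rule set_integral_mono[OF \<phi>set guint])
      fix x assume "x \<in> \<Omega>"
      then have "- G \<le> g (u x)" using G(2)[OF uM] by fastforce
      then show "- G * \<phi> x \<le> g (u x) * \<phi> x"
        using \<phi>0 by (rule mult_right_mono)
    qed
    finally show ?thesis .
  qed
  have UA: "U - A \<le> c / 4 * I"
  proof -
    have "U - A = (LINT x:\<Omega>|lebesgue. g (u x) * \<phi> x - g (v x) * \<phi> x)"
      unfolding U_def A_def using guint gvint by simp
    also have "\<dots> \<le> (LINT x:\<Omega>|lebesgue. c / 4 * \<phi> x)"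
    proof (rule set_integral_mono[OF set_integral_diff(1)[OF guint gvint] \<phi>set])
      fix x assume x: "x \<in> \<Omega>"
      show "g (u x) * \<phi> x - g (v x) * \<phi> x \<le> c / 4 * \<phi> x"
      proof (cases "\<phi> x = 0")
        case False
        then have "u x < \<eta> * v x"
          using x by (auto simp: \<phi>_def max_def split: if_splits)
        then have "u x - v x < (\<eta> - 1) * v x"
          by (simp add: left_diff_distrib)
        then have "\<bar>u x - v x\<bar> < \<delta>"
          using vu x dil[OF x] by auto
        then have "g (u x) - g (v x) \<le> c / 4"
          using \<delta>(2)[OF vM[OF x] uM[OF x]] by linarith
        then show ?thesis
          using mult_right_mono[OF _ \<phi>0[of x]] by (metis left_diff_distrib)
      qed simp
    qed
    also have "\<dots> = c / 4 * I" using I_eq by simp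
    finally show ?thesis .
  qed
  have gain: "c * I \<le> \<eta> powr (p - 1) * Fv - Fu"
  proof -
    have "AE y in lebesgue. y \<in> B \<longrightarrow> \<eta> * v y + e \<le> u y"
    proof (intro AE_I2 impI)
      fix y assume y: "y \<in> B"
      have "\<eta> * v y = v y + (\<eta> - 1) * v y"
        by (simp add: left_diff_distrib)
      then show "\<eta> * v y + e \<le> u y"
        using Bgap[OF y] dil[of y] B\<Omega> y by auto
    qed
    moreover have "B \<in> sets borel" "emeasure lborel B < \<infinity>"
      unfolding B_def by (simp, rule emeasure_bounded_finite) simp
    ultimately have "c * I \<le> frac_plap s p (\<lambda>x. \<eta> * v x) \<phi> - Fu"
      unfolding c_def I_def Fu_def using p s e d wW uW \<phi>W \<phi>int \<phi>pos diam
      by (intro frac_plap_diff_ge[where \<Omega> = \<Omega>])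
         (auto simp: \<phi>_def)
    then show ?thesis
      using \<eta>(1) by (simp add: frac_plap_scale Fv_def)
  qed
  have est: "c * I \<le> (\<eta> powr (p - 1) - 1) * (K + G) * I + \<eta> powr (p - 1) * (c / 4 * I)"
  proof -
    define t where "t = \<eta> powr (p - 1)"
    have t: "1 \<le> t"
      unfolding t_def using \<eta>(1) p by (intro ge_one_powr_ge_zero) auto
    have "c * I \<le> t * Fv - Fu"
      using gain by (simp add: t_def)
    also have "\<dots> \<le> t * (Fu + (U - A)) - Fu"
      using t weak1 by (intro diff_right_mono mult_left_mono) auto
    also have "\<dots> = (t - 1) * Fu + t * (U - A)"
      by (simp add: algebra_simps)
    also have "\<dots> \<le> (t - 1) * ((K + G) * I) + t * (c / 4 * I)"
      using t weak2 U_ge UA by (intro add_mono mult_left_mono) (auto simp: distrib_right)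
    finally show ?thesis by (simp add: t_def mult.assoc)
  qed
  have "I = 0"
  proof (rule ccontr)
    assume "I \<noteq> 0"
    then have I: "0 < I" using I0 by simp
    have "(\<eta> powr (p - 1) - 1) * (K + G) * I < c / 2 * I"
      using \<eta>(3) I by (rule mult_strict_right_mono)
    moreover have "\<eta> powr (p - 1) * (c / 4 * I) \<le> 2 * (c / 4 * I)"
      using \<eta>(2) I c by (intro mult_right_mono) auto
    ultimately show False using est by simp
  qed
  then have "AE x in lborel. \<phi> x = 0"
    using integral_nonneg_eq_0_iff_AE[OF \<phi>int] \<phi>0 by (simp add: I_def)
  then have "AE x in lborel. x \<in> \<Omega> \<longrightarrow> \<eta> * v x - u x \<le> 0"
    by eventually_elim (auto simp: \<phi>_def max_def split: if_splits)
  moreover have "continuous_on \<Omega> (\<lambda>x. \<eta> * v x - u x)"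
    using cu cv by (intro continuous_intros)
  ultimately have "\<eta> * v x - u x \<le> 0" if "x \<in> \<Omega>" for x
    using nonpos_of_AE_nonpos[OF \<Omega>(1)] that by blast
  then show ?thesis
    using \<eta>(1) by auto
qed

text \<open>
  As \<open>u - v \<ge> (\<eta> - 1) v\<close>, a positive lower bound for the quotient of \<open>v\<close> by the weight gives one for
  the quotient of \<open>u - v\<close>.
\<close>
lemma int_Cs0_nonneg_diff:
  fixes \<Omega> :: "'a::euclidean_space set"
  assumes \<Omega>: "open \<Omega>" "bounded \<Omega>" "\<Omega> \<noteq> {}" and s: "0 < s"
    and u: "u \<in> Cs0 s \<Omega>" and v: "v \<in> int_Cs0_nonneg s \<Omega>"
    and \<eta>: "1 < \<eta>" "\<forall>x\<in>\<Omega>. \<eta> * v x \<le> u x"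
  shows "(\<lambda>x. u x - v x) \<in> int_Cs0_nonneg s \<Omega>"
proof -
  let ?q = "\<lambda>w x. w x / dist_compl \<Omega> x powr s"
  have v': "v \<in> Cs0 s \<Omega>" and pos: "0 < (INF x\<in>\<Omega>. ?q v x)"
    using v int_Cs0_nonneg_iff[OF \<Omega> s] by auto
  obtain b where "\<forall>x\<in>\<Omega>. \<bar>?q v x\<bar> \<le> b"
    using Cs0_bounded[OF \<Omega>(2) v'] by blast
  then have "\<forall>x\<in>\<Omega>. - b \<le> ?q v x"
    by (meson abs_le_D2 minus_le_iff)
  then have bdd: "bdd_below (?q v ` \<Omega>)"
    by (intro bdd_belowI2[of _ "- b"]) blast
  have "(\<eta> - 1) * (INF x\<in>\<Omega>. ?q v x) \<le> (INF x\<in>\<Omega>. ?q (\<lambda>x. u x - v x) x)"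
  proof (rule cINF_greatest[OF \<Omega>(3)])
    fix x assume x: "x \<in> \<Omega>"
    have "(\<eta> - 1) * (INF x\<in>\<Omega>. ?q v x) \<le> (\<eta> - 1) * ?q v x"
      using \<eta>(1) cINF_lower[OF bdd x] by (intro mult_left_mono) auto
    also have "\<dots> = ((\<eta> - 1) * v x) / dist_compl \<Omega> x powr s" by simp
    also have "\<dots> \<le> ?q (\<lambda>x. u x - v x) x"
      using \<eta>(2) x by (intro divide_right_mono) (auto simp: left_diff_distrib)
    finally show "(\<eta> - 1) * (INF x\<in>\<Omega>. ?q v x) \<le> ?q (\<lambda>x. u x - v x) x" .
  qed
  moreover have "0 < (\<eta> - 1) * (INF x\<in>\<Omega>. ?q v x)"
    using \<eta>(1) pos by simp
  ultimately show ?thesis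
    using Cs0_diff[OF u v'] int_Cs0_nonneg_iff[OF \<Omega> s] by auto
qed

section \<open>The strong comparison principle\<close>

theorem theorem2p7:
  fixes \<Omega> :: "'a::euclidean_space set"
    and p s K :: real
    and g :: "real \<Rightarrow> real"
    and u v :: "'a \<Rightarrow> real"
  assumes "DIM('a) \<ge> 2"
    and "bounded_C11_domain \<Omega>"
    and "p \<ge> 2" and "0 < s" and "s < 1" and "p * s < real DIM('a)"
    and "continuous_on UNIV g" and "g \<in> BV_loc"
    and "u \<in> Wsp0 s p \<Omega>" and "continuous_on (closure \<Omega>) u"
    and "v \<in> Wsp0 s p \<Omega>" and "continuous_on (closure \<Omega>) v"
    and "\<exists>x\<in>\<Omega>. u x \<noteq> v x"
    and "K > 0"
    and "\<forall>\<phi>\<in>Wsp0_nonneg s p \<Omega>.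
           frac_plap s p v \<phi> + (LINT x:\<Omega>|lebesgue. g (v x) * \<phi> x)
             \<le> frac_plap s p u \<phi> + (LINT x:\<Omega>|lebesgue. g (u x) * \<phi> x) \<and>
           frac_plap s p u \<phi> + (LINT x:\<Omega>|lebesgue. g (u x) * \<phi> x)
             \<le> K * (LINT x:\<Omega>|lebesgue. \<phi> x)"
    and "\<forall>x\<in>\<Omega>. 0 < v x \<and> v x \<le> u x"
  shows "(\<forall>x\<in>\<Omega>. u x > v x) \<and>
         (u \<in> int_Cs0_nonneg s \<Omega> \<and> v \<in> int_Cs0_nonneg s \<Omega>
            \<longrightarrow> (\<lambda>x. u x - v x) \<in> int_Cs0_nonneg s \<Omega>)"
proof -
  have \<Omega>: "open \<Omega>" "bounded \<Omega>" "\<Omega> \<noteq> {}"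
    using assms(2) by (auto simp: bounded_C11_domain_def)
  have "\<exists>\<eta>>1. \<forall>x\<in>\<Omega>. \<eta> * v x \<le> u x"
    by (rule comparison_with_dilation[where g = g and K = K and s = s and p = p])
       (use assms \<Omega> in \<open>auto intro: less_imp_le\<close>)
  then obtain \<eta> where \<eta>: "1 < \<eta>" "\<forall>x\<in>\<Omega>. \<eta> * v x \<le> u x"
    by blast
  have "v x < u x" if x: "x \<in> \<Omega>" for x
  proof -
    have "v x < \<eta> * v x"
      using \<eta>(1) assms(16) x by simp
    then show ?thesis
      using \<eta>(2) x by force
  qed
  moreover have "(\<lambda>x. u x - v x) \<in> int_Cs0_nonneg s \<Omega>"
    if "u \<in> int_Cs0_nonneg s \<Omega>" "v \<in> int_Cs0_nonneg s \<Omega>"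
    using int_Cs0_nonneg_diff[OF \<Omega> assms(4) _ that(2) \<eta>] that(1) int_Cs0_nonneg_iff[OF \<Omega> assms(4)]
    by auto
  ultimately show ?thesis
    by blast
qed

end
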